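(* Fix $k\ge 1$ and any family $\mathcal{F}\subseteq 2^{[k]}\setminus\{\emptyset\}$. For Slot-Heterogenous Paging with $k$ slots and requestable slot sets from $\mathcal{F}$, the online algorithm ExhSearch (described in the context) has competitive ratio at most $k\cdot\min\{|\mathcal{F}^\ast|,\ \mathrm{mass}(\mathcal{F})\}$, where $\mathcal{F}^\ast=\bigcup_{S\in\mathcal{F}}2^{S}$ and $\mathrm{mass}(\mathcal{F})=\sum_{S\in\mathcal{F}}|S|$.
   Context: Slot-Heterogenous Paging: there are cache slots $[k]=\{1,\dots,k\}$ and a family $\mathcal{F}\subseteq 2^{[k]}\setminus\{\emptyset\}$ of requestable slot sets. A request sequence is $\sigma=(\sigma_1,\dots,\sigma_T)$ with $\sigma_t=(p_t,S_t)$, $p_t$ a page and $S_t\in\mathcal{F}$. A cache configuration assigns to each slot either a single page or nothing; it satisfies a request $(p,S)$ if it assigns $p$ to at least one slot in $S$. A solution is a sequence of configurations $C_1,\dots,C_T$ with $C_t$ satisfying $\sigma_t$ for every $t$. Its cost is the number of retrievals, where page $p$ is retrieved in slot $s$ at time $t$ if $C_t$ assigns $p$ to $s$ but $C_{t-1}$ does not (or $t=1$). $\mathrm{OPT}(\sigma)$ is the minimum cost. An online algorithm (choosing $C_t$ knowing only $\sigma_1,\dots,\sigma_t$) is $c$-competitive if there is a constant $b$ independent of $\sigma$ with $\mathrm{cost}(\sigma)\le c\cdot\mathrm{OPT}(\sigma)+b$ for all $\sigma$. Algorithm ExhSearch: let the initial configuration $C_0$ be arbitrary and set $\ell\gets 1$.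 For $t=1,\dots,T$: if $C_{t-1}$ satisfies $\sigma_t$, set $C_t=C_{t-1}$; otherwise, if some configuration satisfies all requests $\sigma_\ell,\sigma_{\ell+1},\dots,\sigma_t$, let $C_t$ be any such configuration; otherwise set $\ell\gets t$ and let $C_t$ be any configuration satisfying $\sigma_t$. *)

theory Defs
  imports Complex_Main
begin

type_synonym 'p request = "'p \<times> nat set"
type_synonym 'p config = "nat \<rightharpoonup> 'p"

definition slots :: "nat \<Rightarrow> nat set" where
  "slots k = {1..k}"

definition configs :: "nat \<Rightarrow> 'p config set" where
  "configs k = {C. dom C \<subseteq> slots k}"

fun satisfies :: "'p config \<Rightarrow> 'p request \<Rightarrow> bool" where
  "satisfies C (p, S) \<longleftrightarrow> (\<exists>s\<in>S. C s = Some p)"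

definition request_seqs :: "nat set set \<Rightarrow> 'p request list set" where
  "request_seqs F = {\<sigma>. \<forall>(p, S)\<in>set \<sigma>. S \<in> F}"

text \<open>
  Times are list indices and hence start at 0: the request \<open>\<sigma> ! t\<close> and the configuration
  \<open>Cs ! t\<close> are those of time \<open>t + 1\<close> in the usual numbering.
\<close>

definition is_solution :: "nat \<Rightarrow> 'p request list \<Rightarrow> 'p config list \<Rightarrow> bool" where
  "is_solution k \<sigma> Cs \<longleftrightarrow>
     length Cs = length \<sigma> \<and>
     (\<forall>t<length \<sigma>. Cs ! t \<in> configs k \<and> satisfies (Cs ! t) (\<sigma> ! t))"

definition retrievals :: "nat \<Rightarrow> 'p config list \<Rightarrow> (nat \<times> nat \<times> 'p) set" where
  "retrievals k Cs =
     {(t, s, p). t < length Cs \<and> s \<in> slots k \<and> (Cs ! t) s = Some p \<and>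
                 (t = 0 \<or> (Cs ! (t - 1)) s \<noteq> Some p)}"

definition cost :: "nat \<Rightarrow> 'p config list \<Rightarrow> nat" where
  "cost k Cs = card (retrievals k Cs)"

definition OPT :: "nat \<Rightarrow> 'p request list \<Rightarrow> nat" where
  "OPT k \<sigma> = (LEAST n. \<exists>Cs. is_solution k \<sigma> Cs \<and> cost k Cs = n)"

text \<open>
  An online algorithm is a function from the requests seen so far to the current configuration;
  its value on the empty list is the initial configuration, which is not part of the solution.
\<close>

type_synonym 'p online = "'p request list \<Rightarrow> 'p config"

definition run :: "'p online \<Rightarrow> 'p request list \<Rightarrow> 'p config list" where
  "run A \<sigma> = map (\<lambda>t. A (take (Suc t) \<sigma>)) [0..<length \<sigma>]"

definition online_algorithm :: "nat \<Rightarrow> nat set set \<Rightarrow> 'p online \<Rightarrow> bool" where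
  "online_algorithm k F A \<longleftrightarrow> (\<forall>\<sigma>\<in>request_seqs F. is_solution k \<sigma> (run A \<sigma>))"

definition competitive :: "nat \<Rightarrow> nat set set \<Rightarrow> real \<Rightarrow> 'p online \<Rightarrow> bool" where
  "competitive k F c A \<longleftrightarrow>
     online_algorithm k F A \<and>
     (\<exists>b::real. \<forall>\<sigma>\<in>request_seqs F. real (cost k (run A \<sigma>)) \<le> c * real (OPT k \<sigma>) + b)"

definition satisfying_configs ::
    "nat \<Rightarrow> 'p request list \<Rightarrow> nat \<Rightarrow> nat \<Rightarrow> 'p config set" where
  "satisfying_configs k \<sigma> l t = {C \<in> configs k. \<forall>i\<in>{l..t}. satisfies C (\<sigma> ! i)}"

definition exh_search_step ::
    "nat \<Rightarrow> 'p request list \<Rightarrow> nat \<Rightarrow> 'p config \<Rightarrow> nat \<Rightarrow> 'p config \<Rightarrow> nat \<Rightarrow> bool" where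
  "exh_search_step k \<sigma> t C l C' l' \<longleftrightarrow>
     (if satisfies C (\<sigma> ! t) then C' = C \<and> l' = l
      else if satisfying_configs k \<sigma> l t \<noteq> {}
        then C' \<in> satisfying_configs k \<sigma> l t \<and> l' = l
      else C' \<in> configs k \<and> satisfies C' (\<sigma> ! t) \<and> l' = t)"

text \<open>
  \<open>exh_search k F A\<close> says that \<open>A\<close> is ExhSearch for some way of making its free choices (the
  initial configuration and, in each step, the new configuration, which may depend on the whole
  history). The value of the variable \<open>\<ell>\<close> before step \<open>t\<close> is \<open>l t\<close>; the
  steps determine it uniquely, so the existential quantifier leaves no freedom.
\<close>

definition exh_search :: "nat \<Rightarrow> nat set set \<Rightarrow> 'p online \<Rightarrow> bool" where
  "exh_search k F A \<longleftrightarrow>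
     A [] \<in> configs k \<and>
     (\<forall>\<sigma>\<in>request_seqs F. \<exists>l. l 0 = 0 \<and>
        (\<forall>t<length \<sigma>.
           exh_search_step k \<sigma> t (A (take t \<sigma>)) (l t) (A (take (Suc t) \<sigma>)) (l (Suc t))))"

definition F_star :: "nat set set \<Rightarrow> nat set set" where
  "F_star F = (\<Union>S\<in>F. Pow S)"

definition mass :: "nat set set \<Rightarrow> nat" where
  "mass F = (\<Sum>S\<in>F. card S)"

lemma ex_satisfying_config:
  assumes "S \<subseteq> slots k" "S \<noteq> {}"
  shows "\<exists>C\<in>configs k. satisfies C (p, S)"
proof -
  obtain s where "s \<in> S" using assms by blast
  then show ?thesis
    using assms by (intro bexI[of _ "[s \<mapsto> p]"]) (auto simp: configs_def)
qed

text \<open>ExhSearch never gets stuck, so there are online algorithms of this kind.\<close>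

lemma exh_search_exists:
  fixes C0 :: "'p config"
  assumes F: "F \<subseteq> Pow (slots k) - {{}}" and C0: "C0 \<in> configs k"
  shows "\<exists>A. exh_search k F A \<and> A [] = C0"
proof -
  define nxt where "nxt = (\<lambda>(\<sigma> :: 'p request list) t y.
    SOME x. exh_search_step k \<sigma> t (fst y) (snd y) (fst x) (snd x))"
  define st :: "'p request list \<Rightarrow> nat \<Rightarrow> 'p config \<times> nat"
    where "st = (\<lambda>\<sigma>. rec_nat (C0, 0) (\<lambda>t s. nxt (take (Suc t) \<sigma>) t s))"
  define A where "A = (\<lambda>\<sigma>. fst (st \<sigma> (length \<sigma>)))"
  have st_0: "st \<sigma> 0 = (C0, 0)" and st_Suc: "st \<sigma> (Suc t) = nxt (take (Suc t) \<sigma>) t (st \<sigma> t)"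
    for \<sigma> t by (simp_all add: st_def)
  have st_take: "t \<le> n \<Longrightarrow> st (take n \<sigma>) t = st \<sigma> t" for \<sigma> t n
    by (induction t) (simp_all add: st_0 st_Suc min_def)
  have A_take: "t \<le> length \<sigma> \<Longrightarrow> A (take t \<sigma>) = fst (st \<sigma> t)" for \<sigma> t
    by (simp add: A_def st_take min_def)
  have ex: "\<exists>C' l'. exh_search_step k \<sigma> t C l C' l'"
    if "\<sigma> \<in> request_seqs F" "t < length \<sigma>" for \<sigma> :: "'p request list" and t C l
  proof -
    obtain p S where pS: "\<sigma> ! t = (p, S)" by fastforce
    have "(p, S) \<in> set \<sigma>" using pS that by (metis nth_mem)
    then have "S \<in> F" using that by (auto simp: request_seqs_def)
    then have "\<exists>C\<in>configs k. satisfies C (\<sigma> ! t)"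
      using ex_satisfying_config[of S k p] F pS by auto
    then show ?thesis unfolding exh_search_step_def
      by (cases "satisfies C (\<sigma> ! t)"; cases "satisfying_configs k \<sigma> l t = {}") auto
  qed
  have loc: "exh_search_step k (take (Suc t) \<sigma>) t C l C' l' = exh_search_step k \<sigma> t C l C' l'"
    for \<sigma> :: "'p request list" and t C l C' l'
  proof -
    have "satisfying_configs k (take (Suc t) \<sigma>) l t = satisfying_configs k \<sigma> l t"
      by (simp add: satisfying_configs_def)
    then show ?thesis by (simp add: exh_search_step_def)
  qed
  have "exh_search_step k \<sigma> t (fst (st \<sigma> t)) (snd (st \<sigma> t)) (fst (st \<sigma> (Suc t))) (snd (st \<sigma> (Suc t)))"
    if "\<sigma> \<in> request_seqs F" "t < length \<sigma>" for \<sigma> t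
  proof -
    have "\<exists>x. exh_search_step k (take (Suc t) \<sigma>) t (fst (st \<sigma> t)) (snd (st \<sigma> t)) (fst x) (snd x)"
      using ex[OF that] by (simp add: loc)
    from someI_ex[OF this] show ?thesis
      by (simp add: st_Suc nxt_def loc)
  qed
  then have "\<exists>l. l 0 = 0 \<and> (\<forall>t<length \<sigma>.
      exh_search_step k \<sigma> t (A (take t \<sigma>)) (l t) (A (take (Suc t) \<sigma>)) (l (Suc t)))"
    if "\<sigma> \<in> request_seqs F" for \<sigma>
    using that by (intro exI[of _ "\<lambda>t. snd (st \<sigma> t)"]) (simp add: A_take st_0)
  then have "exh_search k F A"
    using C0 by (simp add: exh_search_def A_def st_0)
  then show ?thesis by (auto simp: A_def st_0)
qed

end

theory Submission
  imports Defs "HOL-Library.Function_Algebras"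
begin

text \<open>
  Between two resets of \<open>\<ell>\<close> lies a phase. No configuration satisfies all requests of a phase together
  with the one that ends it, so any solution retrieves a page in each completed phase, at pairwise
  distinct times. ExhSearch pays at most \<open>k\<close> per miss, so it remains to bound the number of misses
  within a phase. The configuration before a miss satisfies the earlier missed requests of the phase,
  but not the missed one. Hence the missed requests are distinct and simultaneously satisfiable, and
  choosing a slot that satisfies each of them gives the bound \<open>mass F\<close>. For the bound \<open>card (F_star F)\<close>,
  encode pages as reals and assign to the request \<open>(p, S)\<close> the multilinear polynomial
  \<open>\<Prod>s\<in>S. (x s - a p)\<close>, which vanishes at a configuration iff the configuration satisfies the
  request. Triangularity makes the polynomials of the missed requests linearly independent, and they
  lie in the span of the monomials \<open>\<Prod>s\<in>U. x s\<close> with \<open>U \<in> F_star F\<close>.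
\<close>

section \<open>Linear independence of real-valued functions\<close>

interpretation real_fun: vector_space "\<lambda>(c::real) (f::'a \<Rightarrow> real) x. c * f x"
  by unfold_locales (auto simp: fun_eq_iff algebra_simps)

lemma span_vanishes:
  fixes B :: "('a \<Rightarrow> real) set"
  assumes "f \<in> real_fun.span B" "\<And>g. g \<in> B \<Longrightarrow> g x = 0"
  shows "f x = 0"
  using assms(1)
  by (induction rule: real_fun.span_induct_alt) (simp_all add: assms(2))

lemma triangular_independent:
  fixes f :: "'i::linorder \<Rightarrow> 'a \<Rightarrow> real"
  assumes "finite J"
    and "\<And>i j. i \<in> J \<Longrightarrow> j \<in> J \<Longrightarrow> j < i \<Longrightarrow> f j (x i) = 0"
    and "\<And>j. j \<in> J \<Longrightarrow> f j (x j) \<noteq> 0"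
  shows "\<not> real_fun.dependent (f ` J) \<and> inj_on f J"
  using assms
proof (induction J rule: finite_linorder_max_induct)
  case empty
  then show ?case by (simp add: real_fun.independent_empty)
next
  case (insert b J)
  have "f b \<notin> real_fun.span (f ` J)"
  proof
    assume "f b \<in> real_fun.span (f ` J)"
    then have "f b (x b) = 0"
      by (rule span_vanishes) (use insert in auto)
    then show False using insert.prems(2)[of b] by simp
  qed
  moreover from this have "f b \<notin> f ` J"
    using real_fun.span_base by blast
  moreover have "\<not> real_fun.dependent (f ` J) \<and> inj_on f J"
    by (rule insert.IH) (use insert.prems in auto)
  ultimately show ?case
    using insert.hyps by (auto simp: real_fun.independent_insert)
qed

lemma sum_fun_apply: "(\<Sum>i\<in>I. f i) x = (\<Sum>i\<in>I. f i x)"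
  for f :: "'i \<Rightarrow> 'a \<Rightarrow> 'b::comm_monoid_add"
  by (induction I rule: infinite_finite_induct) simp_all

text \<open>Expanding the product takes from each factor either \<open>x s\<close> or the constant
  \<open>- a\<close>; \<open>U\<close> is the set of slots where \<open>x s\<close> was
  taken.\<close>

lemma prod_diff_in_span_monomials:
  fixes a :: real
  assumes "finite S" "Pow S \<subseteq> G"
  shows "(\<lambda>x. \<Prod>s\<in>S. (x s - a)) \<in> real_fun.span ((\<lambda>U x. \<Prod>s\<in>U. x s) ` G)"
proof -
  have "(\<lambda>x. \<Prod>s\<in>S. (x s - a)) = (\<Sum>U\<in>Pow S. (\<lambda>x. (\<Prod>s\<in>S - U. - a) * (\<Prod>s\<in>U. x s)))"
    using prod_add[OF assms(1), of _ "\<lambda>_. - a"]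
    by (simp add: fun_eq_iff sum_fun_apply mult.commute del: prod_constant)
  also have "\<dots> \<in> real_fun.span ((\<lambda>U x. \<Prod>s\<in>U. x s) ` G)"
    by (intro real_fun.span_sum real_fun.span_scale real_fun.span_base) (use assms in auto)
  finally show ?thesis .
qed

section \<open>Two bounds on families of missed requests\<close>

lemma card_misses_le_card_F_star:
  fixes r :: "nat \<Rightarrow> 'p request" and C :: "nat \<Rightarrow> 'p config"
  assumes J: "finite J" and F: "finite F" "\<And>S. S \<in> F \<Longrightarrow> finite S"
    and r: "\<And>j. j \<in> J \<Longrightarrow> snd (r j) \<in> F"
    and hit: "\<And>i j. i \<in> J \<Longrightarrow> j \<in> J \<Longrightarrow> j < i \<Longrightarrow> satisfies (C i) (r j)"
    and miss: "\<And>j. j \<in> J \<Longrightarrow> \<not> satisfies (C j) (r j)"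
  shows "card J \<le> card (F_star F)"
proof -
  define P where "P = (\<lambda>j. fst (r j)) ` J"
  have "finite P" using J by (simp add: P_def)
  then obtain e :: "'p \<Rightarrow> nat" where e: "inj_on e P"
    using finite_imp_inj_to_nat_seg by metis
  \<comment> \<open>Only finitely many pages are requested, so this works even if the pages do not embed into the reals.\<close>
  define a :: "'p option \<Rightarrow> real"
    where "a = (\<lambda>z. case z of None \<Rightarrow> 0 | Some p \<Rightarrow> if p \<in> P then real (e p) + 1 else 0)"
  \<comment> \<open>Adding 1 to \<open>e p\<close> reserves the value 0 for empty slots and for
    pages outside \<open>P\<close>, so neither is confused with a requested page.\<close>
  have a: "a z = a (Some p) \<longleftrightarrow> z = Some p" if "p \<in> P" for z p
    using that e by (auto simp: a_def inj_on_def split: option.splits)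
  define f where "f = (\<lambda>j (x :: nat \<Rightarrow> real). \<Prod>s\<in>snd (r j). (x s - a (Some (fst (r j)))))"
  define x where "x = (\<lambda>i s. a (C i s))"
  have f_0: "f j (x i) = 0 \<longleftrightarrow> satisfies (C i) (r j)" if "j \<in> J" for i j
  proof -
    have "fst (r j) \<in> P" "finite (snd (r j))" using that r F by (auto simp: P_def)
    then show ?thesis
      by (cases "r j") (auto simp: f_def x_def a)
  qed
  have ind: "\<not> real_fun.dependent (f ` J) \<and> inj_on f J"
    by (rule triangular_independent[OF J, where x = x]) (use f_0 hit miss in auto)
  have fin: "finite (F_star F)" using F by (auto simp: F_star_def)
  let ?M = "(\<lambda>U (x :: nat \<Rightarrow> real). \<Prod>s\<in>U. x s) ` F_star F"
  have "f ` J \<subseteq> real_fun.span ?M"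
    unfolding f_def
    by (intro image_subsetI prod_diff_in_span_monomials) (use r F in \<open>auto simp: F_star_def\<close>)
  then have "card (f ` J) \<le> card ?M"
    using real_fun.independent_span_bound[of ?M "f ` J"] ind fin by blast
  also have "\<dots> \<le> card (F_star F)" using fin by (rule card_image_le)
  finally show ?thesis using ind by (simp add: card_image)
qed

text \<open>A slot of \<open>C\<close> holds at most one page, so a satisfied request is determined
  by its slot set \<open>S\<close> and a slot in \<open>S\<close> that satisfies it. There are
  \<open>mass F\<close> such pairs.\<close>

lemma card_distinct_satisfied_le_mass:
  fixes r :: "'i \<Rightarrow> 'p request"
  assumes F: "finite F" "\<And>S. S \<in> F \<Longrightarrow> finite S"
    and r: "\<And>j. j \<in> J \<Longrightarrow> snd (r j) \<in> F"
    and inj: "inj_on r J"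
    and sat: "\<And>j. j \<in> J \<Longrightarrow> satisfies C (r j)"
  shows "card J \<le> mass F"
proof -
  have "\<forall>j\<in>J. \<exists>s. s \<in> snd (r j) \<and> C s = Some (fst (r j))"
    using sat by (metis prod.collapse satisfies.simps)
  then obtain s where s: "\<And>j. j \<in> J \<Longrightarrow> s j \<in> snd (r j) \<and> C (s j) = Some (fst (r j))"
    by metis
  have "inj_on (\<lambda>j. (snd (r j), s j)) J"
  proof (rule inj_onI)
    fix i j assume ij: "i \<in> J" "j \<in> J" "(snd (r i), s i) = (snd (r j), s j)"
    then have "r i = r j" using s[of i] s[of j] by (auto simp: prod_eq_iff)
    then show "i = j" using inj ij by (auto dest: inj_onD)
  qed
  moreover have "(\<lambda>j. (snd (r j), s j)) ` J \<subseteq> Sigma F (\<lambda>S. S)"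
    using s r by auto
  moreover have "finite (Sigma F (\<lambda>S. S))" using F by auto
  ultimately have "card J \<le> card (Sigma F (\<lambda>S. S))" by (rule card_inj_on_le)
  then show ?thesis using F by (simp add: mass_def)
qed

section \<open>Retrievals and the cost of a solution\<close>

lemma retrievals_subset:
  "retrievals k Cs \<subseteq> (\<lambda>(t, s). (t, s, the ((Cs ! t) s))) `
     ({t. t < length Cs \<and> (t = 0 \<or> Cs ! t \<noteq> Cs ! (t - 1))} \<times> slots k)"
  by (fastforce simp: retrievals_def image_iff)

lemma finite_retrievals: "finite (retrievals k Cs)"
  by (rule finite_subset[OF retrievals_subset]) (auto simp: slots_def)

text \<open>Each time causes at most \<open>k\<close> retrievals, and a time without a change causes
  none, except time 0, where every page present counts. This is the extra 1.\<close>

lemma cost_le_changes: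
  assumes "finite X" "\<And>t. 0 < t \<Longrightarrow> t < length Cs \<Longrightarrow> t \<notin> X \<Longrightarrow> Cs ! t = Cs ! (t - 1)"
  shows "cost k Cs \<le> k * (card X + 1)"
proof -
  let ?h = "\<lambda>(t, s). (t, s, the ((Cs ! t) s))"
  have "retrievals k Cs \<subseteq> ?h ` (insert 0 X \<times> slots k)"
    using assms(2) by (intro order.trans[OF retrievals_subset] image_mono Sigma_mono) auto
  then have "card (retrievals k Cs) \<le> card (?h ` (insert 0 X \<times> slots k))"
    by (rule card_mono[rotated]) (use assms in \<open>auto simp: slots_def\<close>)
  also have "\<dots> \<le> card (insert 0 X \<times> slots k)"
    by (rule card_image_le) (use assms in \<open>auto simp: slots_def\<close>)
  also have "\<dots> = card (insert 0 X) * k"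
    by (simp add: card_cartesian_product slots_def)
  also have "\<dots> \<le> (card X + 1) * k"
    using assms(1) by (intro mult_right_mono) (auto simp: card_insert_if)
  finally show ?thesis by (simp add: cost_def mult.commute)
qed

lemma satisfies_map_le: "satisfies D r \<Longrightarrow> D \<subseteq>\<^sub>m C \<Longrightarrow> satisfies C r"
  by (cases r) (force simp: map_le_def dom_def)

text \<open>Without retrievals a slot can only keep or lose its page.\<close>

lemma no_retrievals_map_le:
  assumes Cs: "\<And>t. t < length Cs \<Longrightarrow> Cs ! t \<in> configs k"
    and no: "\<And>\<tau> s p. (\<tau>, s, p) \<in> retrievals k Cs \<Longrightarrow> \<tau> \<notin> {a<..b}"
    and "a \<le> i" "i \<le> b" "b < length Cs"
  shows "Cs ! i \<subseteq>\<^sub>m Cs ! a"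
  using assms(3,4)
proof (induction i rule: dec_induct)
  case base
  then show ?case by simp
next
  case (step n)
  have "Cs ! Suc n \<subseteq>\<^sub>m Cs ! n"
    unfolding map_le_def
  proof
    fix s assume "s \<in> dom (Cs ! Suc n)"
    then obtain p where p: "(Cs ! Suc n) s = Some p" by blast
    have "Cs ! Suc n \<in> configs k" using Cs step assms(5) by auto
    then have "s \<in> slots k" using p by (auto simp: configs_def)
    moreover have "(Suc n, s, p) \<notin> retrievals k Cs" using no[of "Suc n" s p] step by auto
    ultimately show "(Cs ! Suc n) s = (Cs ! n) s"
      using p step assms(5) by (auto simp: retrievals_def)
  qed
  then show ?case using step by (meson Suc_leD map_le_trans)
qed

text \<open>Otherwise \<open>Cs ! a\<close> would extend all configurations up to time
  \<open>b\<close> and so satisfy all these requests by itself. Excluding \<open>a\<close> from the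
  interval later makes the intervals of consecutive phases disjoint.\<close>

lemma ex_retrieval_if_unsatisfiable:
  assumes sol: "is_solution k \<sigma> Cs" and "a \<le> b" "b < length \<sigma>"
    and unsat: "satisfying_configs k \<sigma> a b = {}"
  shows "\<exists>\<tau>\<in>{a<..b}. \<exists>s p. (\<tau>, s, p) \<in> retrievals k Cs"
proof (rule ccontr)
  assume no: "\<not> ?thesis"
  have "satisfies (Cs ! a) (\<sigma> ! i)" if "i \<in> {a..b}" for i
  proof (rule satisfies_map_le)
    show "satisfies (Cs ! i) (\<sigma> ! i)" using sol that assms(3) by (auto simp: is_solution_def)
    show "Cs ! i \<subseteq>\<^sub>m Cs ! a"
      by (rule no_retrievals_map_le[where k = k and b = b])
        (use sol no that assms(3) in \<open>auto simp: is_solution_def\<close>)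
  qed
  moreover have "Cs ! a \<in> configs k" using sol assms by (auto simp: is_solution_def)
  ultimately show False using unsat by (auto simp: satisfying_configs_def)
qed

section \<open>Phases of a run of ExhSearch\<close>

locale exh_search_run =
  fixes k :: nat and F :: "nat set set" and \<sigma> :: "'p request list"
    and C :: "nat \<Rightarrow> 'p config" and l :: "nat \<Rightarrow> nat"
  assumes F: "F \<subseteq> Pow (slots k)"
    and \<sigma>: "\<sigma> \<in> request_seqs F"
    and C_0: "C 0 \<in> configs k"
    and l_0: "l 0 = 0"
    and step: "\<And>t. t < length \<sigma> \<Longrightarrow> exh_search_step k \<sigma> t (C t) (l t) (C (Suc t)) (l (Suc t))"
begin

definition misses :: "nat set" where
  "misses = {t. t < length \<sigma> \<and> \<not> satisfies (C t) (\<sigma> ! t)}"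

definition resets :: "nat set" where
  "resets = {t \<in> misses. satisfying_configs k \<sigma> (l t) t = {}}"

lemma finite_misses: "finite misses"
  by (simp add: misses_def)

lemma finite_resets: "finite resets"
  using finite_misses by (simp add: resets_def)

lemma C_Suc_no_miss: "t < length \<sigma> \<Longrightarrow> t \<notin> misses \<Longrightarrow> C (Suc t) = C t"
  using step[of t] by (simp add: misses_def exh_search_step_def)

lemma l_Suc: "t < length \<sigma> \<Longrightarrow> l (Suc t) = (if t \<in> resets then t else l t)"
  using step[of t] by (auto simp: misses_def resets_def exh_search_step_def split: if_splits)

lemma l_le: "t \<le> length \<sigma> \<Longrightarrow> l t \<le> t"
  by (induction t) (auto simp: l_0 l_Suc)

lemma l_Suc_le: "t < length \<sigma> \<Longrightarrow> l (Suc t) \<le> t"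
  using l_le[of t] by (auto simp: l_Suc)

lemma l_mono: "i \<le> j \<Longrightarrow> j \<le> length \<sigma> \<Longrightarrow> l i \<le> l j"
proof (induction j rule: dec_induct)
  case (step n)
  then have "l i \<le> l n" by simp
  also have "l n \<le> l (Suc n)" using step l_le[of n] by (simp add: l_Suc)
  finally show ?case .
qed simp

text \<open>Phases are named by their starting times; 0 is added because the first phase starts
  without a reset.\<close>

lemma l_in_resets: "t \<le> length \<sigma> \<Longrightarrow> l t \<in> insert 0 resets"
  by (induction t) (auto simp: l_0 l_Suc)

lemma C_config: "t \<le> length \<sigma> \<Longrightarrow> C t \<in> configs k"
proof (induction t)
  case (Suc t)
  then show ?case using step[of t]
    by (auto simp: exh_search_step_def satisfying_configs_def split: if_splits)
qed (simp add: C_0)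

text \<open>Invariant of the algorithm: a kept configuration also satisfies the new request, a
  recomputed one is chosen to satisfy the whole phase, and after a reset the phase consists of the
  new request only.\<close>

lemma C_satisfies_phase: "t \<le> length \<sigma> \<Longrightarrow> i \<in> {l t..<t} \<Longrightarrow> satisfies (C t) (\<sigma> ! i)"
proof (induction t arbitrary: i)
  case (Suc t)
  show ?case
  proof (cases "satisfies (C t) (\<sigma> ! t)")
    case True
    then have "C (Suc t) = C t" "l (Suc t) = l t"
      using step[of t] Suc.prems by (auto simp: exh_search_step_def)
    then show ?thesis using Suc True by (cases "i = t") auto
  next
    case False
    then show ?thesis using step[of t] Suc.prems
      by (auto simp: exh_search_step_def satisfying_configs_def less_Suc_eq_le split: if_splits)
  qed
qed simp

text \<open>The list omits \<open>C 0\<close>: request \<open>t\<close> is answered by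
  \<open>C (Suc t)\<close>, while \<open>C t\<close> is the configuration that meets it.\<close>

lemma is_solution: "is_solution k \<sigma> (map (\<lambda>t. C (Suc t)) [0..<length \<sigma>])"
  using C_config C_satisfies_phase l_Suc_le by (auto simp: is_solution_def)

lemma finite_F: "finite F" and finite_slot_set: "S \<in> F \<Longrightarrow> finite S"
proof -
  have "finite (slots k)" by (simp add: slots_def)
  then show "finite F" "S \<in> F \<Longrightarrow> finite S" using F by (auto dest: finite_subset)
qed

text \<open>Using the value of \<open>l\<close> after the step counts a resetting request in the
  phase that it opens.\<close>

lemma card_misses_phase:
  "card {t \<in> misses. l (Suc t) = L} \<le> min (card (F_star F)) (mass F)"
proof -
  let ?J = "{t \<in> misses. l (Suc t) = L}"
  have J: "finite ?J" using finite_misses by simp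
  have J_less: "j < length \<sigma>" if "j \<in> ?J" for j using that by (simp add: misses_def)
  have L_le: "L \<le> j" if "j \<in> ?J" for j
    using that l_Suc_le[of j] J_less[OF that] by auto
  have r: "snd (\<sigma> ! j) \<in> F" if "j \<in> ?J" for j
    using \<sigma> nth_mem[OF J_less[OF that]] by (auto simp: request_seqs_def)
  have hit: "satisfies (C i) (\<sigma> ! j)" if "i \<in> ?J" "j \<in> ?J" "j < i" for i j
  proof (rule C_satisfies_phase)
    have "l i \<le> l (Suc i)" using J_less[OF that(1)] by (intro l_mono) auto
    then show "i \<le> length \<sigma>" "j \<in> {l i..<i}"
      using that L_le[OF that(2)] J_less[OF that(1)] by auto
  qed
  have miss: "\<not> satisfies (C j) (\<sigma> ! j)" if "j \<in> ?J" for j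
    using that by (simp add: misses_def)
  have inj: "inj_on ((!) \<sigma>) ?J"
  proof (rule linorder_inj_onI)
    fix j i assume "j < i" "j \<in> ?J" "i \<in> ?J"
    then show "\<sigma> ! j \<noteq> \<sigma> ! i" using hit[of i j] miss[of i] by metis
  qed auto
  have "card ?J \<le> mass F"
  proof (cases "?J = {}")
    case False
    \<comment> \<open>The configuration chosen at the last miss of the phase satisfies all its
      missed requests at once.\<close>
    let ?m = "Max ?J"
    have m: "?m \<in> ?J" using J False by (rule Max_in)
    have sat: "satisfies (C (Suc ?m)) (\<sigma> ! j)" if "j \<in> ?J" for j
      by (rule C_satisfies_phase)
        (use m J_less[OF m] L_le[OF that] Max_ge[OF J that] in auto)
    show ?thesis
      by (rule card_distinct_satisfied_le_mass[OF finite_F finite_slot_set r inj sat])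
  next
    case True
    then show ?thesis by (metis card.empty le0)
  qed
  moreover have "card ?J \<le> card (F_star F)"
    by (rule card_misses_le_card_F_star[OF J finite_F finite_slot_set r hit miss])
  ultimately show ?thesis by simp
qed

lemma card_misses:
  "card misses \<le> (card resets + 1) * min (card (F_star F)) (mass F)"
proof -
  have "card misses \<le> card (\<Union>L\<in>insert 0 resets. {t \<in> misses. l (Suc t) = L})"
  proof (rule card_mono)
    show "misses \<subseteq> (\<Union>L\<in>insert 0 resets. {t \<in> misses. l (Suc t) = L})"
    proof
      fix t assume "t \<in> misses"
      moreover from this have "l (Suc t) \<in> insert 0 resets"
        by (intro l_in_resets) (simp add: misses_def)
      ultimately show "t \<in> (\<Union>L\<in>insert 0 resets. {t \<in> misses. l (Suc t) = L})" by blast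
    qed
  qed (simp add: finite_misses finite_resets)
  also have "\<dots> \<le> (\<Sum>L\<in>insert 0 resets. card {t \<in> misses. l (Suc t) = L})"
    by (rule card_UN_le) (simp add: finite_resets)
  also have "\<dots> \<le> (\<Sum>L\<in>insert 0 resets. min (card (F_star F)) (mass F))"
    by (intro sum_mono card_misses_phase)
  also have "\<dots> \<le> (card resets + 1) * min (card (F_star F)) (mass F)"
    unfolding sum_constant of_nat_id
    by (intro mult_right_mono) (auto simp: card_insert_if finite_resets)
  finally show ?thesis .
qed

lemma card_resets_le_cost:
  assumes "is_solution k \<sigma> Cs"
  shows "card resets \<le> cost k Cs"
proof -
  have less: "L < length \<sigma>" if "L \<in> resets" for L
    using that by (simp add: resets_def misses_def)
  have "\<exists>\<tau>\<in>{l L<..L}. \<exists>s p. (\<tau>, s, p) \<in> retrievals k Cs" if "L \<in> resets" for L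
    using assms l_le less[OF that] that
    by (intro ex_retrieval_if_unsatisfiable) (auto simp: resets_def)
  then obtain \<tau> where \<tau>: "\<And>L. L \<in> resets \<Longrightarrow> \<tau> L \<in> {l L<..L} \<and> \<tau> L \<in> fst ` retrievals k Cs"
    by (metis fst_conv image_eqI)
  \<comment> \<open>After a reset at \<open>L\<close>, \<open>l\<close> never falls below
    \<open>L\<close>, so the left-open interval of a later reset lies entirely after
    \<open>L\<close>.\<close>
  have "\<tau> L < \<tau> L'" if "L \<in> resets" "L' \<in> resets" "L < L'" for L L'
  proof -
    have "\<tau> L \<le> L" using \<tau> that by auto
    also have "L = l (Suc L)" using that less by (simp add: l_Suc)
    also have "\<dots> \<le> l L'" using that less[of L'] by (intro l_mono) auto
    also have "\<dots> < \<tau> L'" using \<tau> that by auto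
    finally show ?thesis .
  qed
  then have "inj_on \<tau> resets"
    by (intro strict_mono_on_imp_inj_on strict_mono_onI)
  then have "card resets \<le> card (fst ` retrievals k Cs)"
    by (rule card_inj_on_le) (use \<tau> finite_retrievals in auto)
  also have "\<dots> \<le> cost k Cs"
    unfolding cost_def by (rule card_image_le[OF finite_retrievals])
  finally show ?thesis .
qed

lemma cost_le_OPT:
  defines "M \<equiv> min (card (F_star F)) (mass F)"
  shows "cost k (map (\<lambda>t. C (Suc t)) [0..<length \<sigma>]) \<le> k * M * OPT k \<sigma> + k * (M + 1)"
proof -
  have "\<exists>Cs. is_solution k \<sigma> Cs \<and> cost k Cs = OPT k \<sigma>"
    unfolding OPT_def by (rule LeastI_ex) (use is_solution in blast)
  then have "card resets \<le> OPT k \<sigma>" using card_resets_le_cost by metis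
  then have "(card resets + 1) * M \<le> (OPT k \<sigma> + 1) * M" by (intro mult_right_mono) auto
  then have "card misses \<le> (OPT k \<sigma> + 1) * M"
    using card_misses unfolding M_def by (rule order_trans[rotated])
  moreover have "cost k (map (\<lambda>t. C (Suc t)) [0..<length \<sigma>]) \<le> k * (card misses + 1)"
    by (rule cost_le_changes[OF finite_misses]) (auto simp: C_Suc_no_miss gr0_conv_Suc)
  \<comment> \<open>The 1 added to \<open>OPT k \<sigma>\<close> accounts for the last phase, which
    no reset ends; the outer 1 accounts for time 0. Both go into the additive constant.\<close>
  ultimately have "cost k (map (\<lambda>t. C (Suc t)) [0..<length \<sigma>]) \<le> k * ((OPT k \<sigma> + 1) * M + 1)"
    by (meson add_le_mono1 mult_le_mono2 order_trans)
  then show ?thesis by (simp add: algebra_simps)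
qed

end

theorem theorem1:
  fixes k :: nat and F :: "nat set set" and A :: "'p online"
  assumes "k \<ge> 1"
    and "F \<subseteq> Pow (slots k) - {{}}"
    and "exh_search k F A"
  shows "competitive k F (real (k * min (card (F_star F)) (mass F))) A"
proof -
  let ?M = "min (card (F_star F)) (mass F)"
  have run: "is_solution k \<sigma> (run A \<sigma>) \<and>
      cost k (run A \<sigma>) \<le> k * ?M * OPT k \<sigma> + k * (?M + 1)"
    if \<sigma>: "\<sigma> \<in> request_seqs F" for \<sigma>
  proof -
    obtain l where l: "l 0 = 0" "\<And>t. t < length \<sigma> \<Longrightarrow>
        exh_search_step k \<sigma> t (A (take t \<sigma>)) (l t) (A (take (Suc t) \<sigma>)) (l (Suc t))"
      using assms(3) \<sigma> unfolding exh_search_def by blast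
    interpret exh_search_run k F \<sigma> "\<lambda>t. A (take t \<sigma>)" l
      by unfold_locales (use assms \<sigma> l in \<open>auto simp: exh_search_def\<close>)
    show ?thesis using is_solution cost_le_OPT by (simp add: run_def)
  qed
  have "real (cost k (run A \<sigma>)) \<le> real (k * ?M) * real (OPT k \<sigma>) + real (k * (?M + 1))"
    if "\<sigma> \<in> request_seqs F" for \<sigma>
    using run[OF that] by (simp only: of_nat_le_iff flip: of_nat_mult of_nat_add)
  then show ?thesis
    unfolding competitive_def online_algorithm_def using run by blast
qed

end
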